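(* Let $\Omega\subset\mathbb H$ be a domain and $f\in C^1(\Omega,\mathbb H)$. Then, on $\Omega$, 1. $-2\,\nu[f]=\mathbf x\,\mathcal D[f]+\mathcal D[\mathbf x f]+3f$, 2. $\nu[f]=-\mathbf x\,\mathcal D[f]+\sum_{k=0}^3[\mathbf x,\mathrm{Grad} f_k]\,\mathbf e_k$.
   Context: $\mathbb H\cong\mathbb R^4$ is the skew field of real quaternions $x=x_0+x_1\mathbf e_1+x_2\mathbf e_2+x_3\mathbf e_3$, with $\mathbf e_k^2=-1$ and $\mathbf e_1\mathbf e_2\mathbf e_3=-1$; $\mathbf e_0=1$. The vector part of $x$ is $\mathbf x=x_1\mathbf e_1+x_2\mathbf e_2+x_3\mathbf e_3$, identified with $(x_1,x_2,x_3)\in\mathbb R^3$; $\mathbf x$ also denotes the function $x\mapsto\mathbf x$. Write $f=\sum_{k=0}^3 f_k\mathbf e_k$ with $f_k$ real valued and $\partial_k=\partial/\partial x_k$. $\mathcal D[f]=\sum_{k=0}^3\mathbf e_k\,\partial_k f$ is the (left) Fueter operator; $\nu[f]=-\mathbf x\,\partial_0 f+\sum_{k=1}^3 x_k\partial_k f$. For real valued $u$, $\mathrm{Grad}\,u=\sum_{k=1}^3\mathbf e_k\partial_k u$. For $\mathbf a,\mathbf b\in\mathbb R^3$, $[\mathbf a,\mathbf b]=\frac12(\mathbf a\mathbf b-\mathbf b\mathbf a)$ is the vector (cross) product. $[\mathbf x,\mathrm{Grad}f_k]\mathbf e_k$ is a quaternionic product. *)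

theory Defs
  imports "HOL-Analysis.Analysis"
begin

section \<open>The skew field of real quaternions\<close>

datatype quat = Quat (Q0: real) (Q1: real) (Q2: real) (Q3: real)

lemma quat_eq_iff: "x = y \<longleftrightarrow> Q0 x = Q0 y \<and> Q1 x = Q1 y \<and> Q2 x = Q2 y \<and> Q3 x = Q3 y"
  by (auto intro: quat.expand)

instantiation quat :: ring_1
begin

definition "0 = Quat 0 0 0 0"
definition "1 = Quat 1 0 0 0"
definition "x + y = Quat (Q0 x + Q0 y) (Q1 x + Q1 y) (Q2 x + Q2 y) (Q3 x + Q3 y)"
definition "- x = Quat (- Q0 x) (- Q1 x) (- Q2 x) (- Q3 x)"
definition "x - y = Quat (Q0 x - Q0 y) (Q1 x - Q1 y) (Q2 x - Q2 y) (Q3 x - Q3 y)"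
definition "x * y = Quat
  (Q0 x * Q0 y - Q1 x * Q1 y - Q2 x * Q2 y - Q3 x * Q3 y)
  (Q0 x * Q1 y + Q1 x * Q0 y + Q2 x * Q3 y - Q3 x * Q2 y)
  (Q0 x * Q2 y - Q1 x * Q3 y + Q2 x * Q0 y + Q3 x * Q1 y)
  (Q0 x * Q3 y + Q1 x * Q2 y - Q2 x * Q1 y + Q3 x * Q0 y)"

instance
  by standard
    (simp_all add: quat_eq_iff zero_quat_def one_quat_def plus_quat_def uminus_quat_def
      minus_quat_def times_quat_def algebra_simps)

end

text \<open>The topology and norm are those of \<open>\<real>\<^sup>4\<close>.\<close>

instantiation quat :: real_inner
begin

definition "r *\<^sub>R x = Quat (r * Q0 x) (r * Q1 x) (r * Q2 x) (r * Q3 x)"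
definition "x \<bullet> y = Q0 x * Q0 y + Q1 x * Q1 y + Q2 x * Q2 y + Q3 x * Q3 y"
definition norm_quat :: "quat \<Rightarrow> real"
  where "norm_quat x = sqrt (x \<bullet> x)"
definition sgn_quat :: "quat \<Rightarrow> quat"
  where "sgn_quat x = inverse (norm x) *\<^sub>R x"
definition dist_quat :: "quat \<Rightarrow> quat \<Rightarrow> real"
  where "dist_quat x y = norm (x - y)"
definition uniformity_quat :: "(quat \<times> quat) filter"
  where "uniformity_quat = (INF e\<in>{0<..}. principal {(x, y). dist x y < e})"
definition open_quat :: "quat set \<Rightarrow> bool"
  where "open_quat U = (\<forall>x\<in>U. \<forall>\<^sub>F (x', y) in uniformity. x' = x \<longrightarrow> y \<in> U)"

instance
proof
  fix x :: quat
  have nn: "0 \<le> Q0 x * Q0 x" "0 \<le> Q1 x * Q1 x" "0 \<le> Q2 x * Q2 x" "0 \<le> Q3 x * Q3 x"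
    by simp_all
  show "0 \<le> x \<bullet> x"
    unfolding inner_quat_def using nn by linarith
  show "x \<bullet> x = 0 \<longleftrightarrow> x = 0"
  proof
    assume "x \<bullet> x = 0"
    then have "Q0 x * Q0 x + Q1 x * Q1 x + Q2 x * Q2 x + Q3 x * Q3 x = 0"
      by (simp add: inner_quat_def)
    with nn have "Q0 x * Q0 x = 0" "Q1 x * Q1 x = 0" "Q2 x * Q2 x = 0" "Q3 x * Q3 x = 0"
      by linarith+
    then show "x = 0"
      by (simp add: quat_eq_iff zero_quat_def)
  qed (simp add: inner_quat_def zero_quat_def)
qed (simp_all add: quat_eq_iff plus_quat_def minus_quat_def uminus_quat_def zero_quat_def
      scaleR_quat_def inner_quat_def norm_quat_def sgn_quat_def dist_quat_def
      uniformity_quat_def open_quat_def algebra_simps)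

end

instantiation quat :: real_normed_div_algebra
begin

definition inverse_quat :: "quat \<Rightarrow> quat"
  where "inverse_quat x = (1 / (x \<bullet> x)) *\<^sub>R Quat (Q0 x) (- Q1 x) (- Q2 x) (- Q3 x)"
definition divide_quat :: "quat \<Rightarrow> quat \<Rightarrow> quat"
  where "divide_quat x y = x * inverse y"

instance
proof
  fix x y :: quat and r :: real
  show "r *\<^sub>R x * y = r *\<^sub>R (x * y)" "x * r *\<^sub>R y = r *\<^sub>R (x * y)"
    by (simp_all add: quat_eq_iff scaleR_quat_def times_quat_def algebra_simps)
  show "norm (x * y) = norm x * norm y"
    unfolding norm_quat_def real_sqrt_mult[symmetric]
    by (simp add: inner_quat_def times_quat_def algebra_simps)
  show "inverse (0 :: quat) = 0"
    by (simp add: inverse_quat_def inner_quat_def scaleR_quat_def zero_quat_def)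
  assume "x \<noteq> 0"
  then have n: "x \<bullet> x \<noteq> 0"
    by simp
  have "Quat (Q0 x) (- Q1 x) (- Q2 x) (- Q3 x) * x = (x \<bullet> x) *\<^sub>R 1"
       "x * Quat (Q0 x) (- Q1 x) (- Q2 x) (- Q3 x) = (x \<bullet> x) *\<^sub>R 1"
    by (simp_all add: quat_eq_iff inner_quat_def times_quat_def scaleR_quat_def one_quat_def)
  moreover have "inverse x * x = (1 / (x \<bullet> x)) *\<^sub>R (Quat (Q0 x) (- Q1 x) (- Q2 x) (- Q3 x) * x)"
       "x * inverse x = (1 / (x \<bullet> x)) *\<^sub>R (x * Quat (Q0 x) (- Q1 x) (- Q2 x) (- Q3 x))"
    by (simp_all add: quat_eq_iff inverse_quat_def times_quat_def scaleR_quat_def algebra_simps)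
  ultimately show "inverse x * x = 1" "x * inverse x = 1"
    using n by simp_all
qed (simp_all add: divide_quat_def)

end

text \<open>Basis units and real components are indexed by natural numbers; only the indices
  \<open>0\<close>, \<open>1\<close>, \<open>2\<close>, \<open>3\<close> are meaningful.\<close>

definition qe :: "nat \<Rightarrow> quat"
  where "qe k = (if k = 0 then Quat 1 0 0 0 else if k = 1 then Quat 0 1 0 0
    else if k = 2 then Quat 0 0 1 0 else if k = 3 then Quat 0 0 0 1 else 0)"

definition qcomp :: "nat \<Rightarrow> quat \<Rightarrow> real"
  where "qcomp k x = (if k = 0 then Q0 x else if k = 1 then Q1 x
    else if k = 2 then Q2 x else if k = 3 then Q3 x else 0)"

lemma qe_relations:
  "qe 0 = 1" "qe 1 * qe 1 = - 1" "qe 2 * qe 2 = - 1" "qe 3 * qe 3 = - 1"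
  "qe 1 * qe 2 * qe 3 = - 1"
  by (simp_all add: qe_def quat_eq_iff one_quat_def uminus_quat_def times_quat_def)

lemma quat_expansion: "x = (\<Sum>k = 0..3. qcomp k x *\<^sub>R qe k)"
  by (simp add: numeral_eq_Suc qe_def qcomp_def quat_eq_iff zero_quat_def one_quat_def
      plus_quat_def times_quat_def scaleR_quat_def)

definition vecpart :: "quat \<Rightarrow> quat"
  where "vecpart x = (\<Sum>k = 1..3. qcomp k x *\<^sub>R qe k)"

text \<open>On quaternions with vanishing real part this is the cross product of \<open>\<real>\<^sup>3\<close>.\<close>

definition qbracket :: "quat \<Rightarrow> quat \<Rightarrow> quat"
  where "qbracket a b = (1 / 2) *\<^sub>R (a * b - b * a)"

lemma qbracket_cross:
  "qbracket (Quat 0 a1 a2 a3) (Quat 0 b1 b2 b3) =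
    Quat 0 (a2 * b3 - a3 * b2) (a3 * b1 - a1 * b3) (a1 * b2 - a2 * b1)"
  by (simp add: qbracket_def quat_eq_iff scaleR_quat_def minus_quat_def times_quat_def)


section \<open>Differential operators\<close>

definition pderiv_at :: "nat \<Rightarrow> (quat \<Rightarrow> 'a::real_normed_vector) \<Rightarrow> quat \<Rightarrow> 'a"
  where "pderiv_at k f x = vector_derivative (\<lambda>t. f (x + t *\<^sub>R qe k)) (at 0)"

definition C1_on :: "quat set \<Rightarrow> (quat \<Rightarrow> quat) \<Rightarrow> bool"
  where "C1_on \<Omega> f \<longleftrightarrow> (\<forall>k\<in>{0..3}.
    (\<forall>x\<in>\<Omega>. (\<lambda>t::real. f (x + t *\<^sub>R qe k)) differentiable (at 0)) \<and>
    continuous_on \<Omega> (pderiv_at k f))"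

definition fueter :: "(quat \<Rightarrow> quat) \<Rightarrow> quat \<Rightarrow> quat"
  where "fueter f x = (\<Sum>k = 0..3. qe k * pderiv_at k f x)"

definition nu :: "(quat \<Rightarrow> quat) \<Rightarrow> quat \<Rightarrow> quat"
  where "nu f x = - vecpart x * pderiv_at 0 f x + (\<Sum>k = 1..3. qcomp k x *\<^sub>R pderiv_at k f x)"

definition Grad :: "(quat \<Rightarrow> real) \<Rightarrow> quat \<Rightarrow> quat"
  where "Grad u x = (\<Sum>k = 1..3. pderiv_at k u x *\<^sub>R qe k)"

end

theory Submission
  imports Defs
begin

text \<open>
  Both identities are pointwise algebra in the first partial derivatives of \<open>f\<close>. Write
  \<open>\<^bold>x\<close> for the vector part of \<open>x\<close>. For an imaginary unit \<open>e\<^sub>k\<close>, the symmetric part of the product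
  \<open>\<^bold>x e\<^sub>k\<close> is minus the inner product and its antisymmetric part is the cross product:

    \<open>\<^bold>x e\<^sub>k + e\<^sub>k \<^bold>x = - 2 x\<^sub>k\<close>  and  \<open>\<^bold>x e\<^sub>k = - x\<^sub>k + [\<^bold>x, e\<^sub>k]\<close>.

  For the first identity, the Leibniz rule (\<open>fueter_vecpart_mult\<close>) gives
  \<open>D[\<^bold>x f] = - 3 f + \<Sum>\<^sub>k e\<^sub>k \<^bold>x \<partial>\<^sub>k f\<close>, where \<open>- 3\<close> is the sum of the squares of the three imaginary
  units. Adding \<open>\<^bold>x D[f] = \<Sum>\<^sub>k \<^bold>x e\<^sub>k \<partial>\<^sub>k f\<close> leaves \<open>\<Sum>\<^sub>k (\<^bold>x e\<^sub>k + e\<^sub>k \<^bold>x) \<partial>\<^sub>k f\<close>, in which the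
  term \<open>k = 0\<close> is \<open>2 \<^bold>x \<partial>\<^sub>0 f\<close> and the others are \<open>- 2 x\<^sub>k \<partial>\<^sub>k f\<close>; this is \<open>- 2 \<nu>[f]\<close>.

  For the second identity, the decomposition of \<open>\<^bold>x e\<^sub>k\<close> gives
  \<open>\<^bold>x D[f] = - \<nu>[f] + \<Sum>\<^sub>k [\<^bold>x, e\<^sub>k] \<partial>\<^sub>k f\<close>, the sum running over the imaginary units. Expanding each
  \<open>\<partial>\<^sub>k f\<close> in components, pulling the real numbers \<open>\<partial>\<^sub>k f\<^sub>j\<close> into the bracket and exchanging the two
  sums turns the last sum into \<open>\<Sum>\<^sub>j [\<^bold>x, Grad f\<^sub>j] e\<^sub>j\<close> (\<open>sum_qbracket_Grad\<close>).
\<close>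

lemma sum_from_0_split: "(\<Sum>k = 0..3. g k) = g 0 + (\<Sum>k = 1..3. g k)"
  for g :: "nat \<Rightarrow> 'a::ab_group_add"
  using sum.atLeast_Suc_atMost[of 0 3 g] by simp

lemma qcomp_eq_inner: "qcomp k y = y \<bullet> qe k"
  by (simp add: qcomp_def qe_def inner_quat_def zero_quat_def)

lemma bounded_linear_qcomp: "bounded_linear (qcomp k)"
  unfolding qcomp_eq_inner by (rule bounded_linear_inner_left)

lemma vecpart_add_scaleR: "vecpart (x + t *\<^sub>R y) = vecpart x + t *\<^sub>R vecpart y"
  unfolding vecpart_def qcomp_eq_inner
  by (simp add: inner_add_left scaleR_add_left sum.distrib scaleR_sum_right)

lemma vecpart_qe:
  "vecpart (qe 0) = 0" "k \<in> {1..3} \<Longrightarrow> vecpart (qe k) = qe k"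
proof -
  show "vecpart (qe 0) = 0"
    by (simp add: vecpart_def qcomp_def qe_def numeral_eq_Suc)
  assume "k \<in> {1..3}"
  then have "k = 1 \<or> k = 2 \<or> k = 3" by auto
  then show "vecpart (qe k) = qe k"
    by (auto simp: vecpart_def qcomp_def qe_def numeral_eq_Suc scaleR_quat_def
        plus_quat_def zero_quat_def)
qed

lemma vecpart_anticommutator:
  assumes "k \<in> {1..3}"
  shows "vecpart x * qe k + qe k * vecpart x = (- 2 * qcomp k x) *\<^sub>R 1"
proof -
  have "k = 1 \<or> k = 2 \<or> k = 3" using assms by auto
  then show ?thesis
    by (auto simp: vecpart_def qcomp_def qe_def numeral_eq_Suc scaleR_quat_def
        plus_quat_def times_quat_def zero_quat_def one_quat_def)
qed

lemma qbracket_vecpart_qe: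
  assumes "k \<in> {1..3}"
  shows "qbracket (vecpart x) (qe k) = vecpart x * qe k + qcomp k x *\<^sub>R 1"
proof -
  have "qe k * vecpart x = (- 2 * qcomp k x) *\<^sub>R 1 - vecpart x * qe k"
    using vecpart_anticommutator[OF assms] by (simp add: algebra_simps)
  then have "vecpart x * qe k - qe k * vecpart x
      = 2 *\<^sub>R (vecpart x * qe k + qcomp k x *\<^sub>R 1)"
    by (simp add: scaleR_2 scaleR_add_right flip: scaleR_add_left)
  then show ?thesis
    by (simp add: qbracket_def)
qed

lemma qbracket_sum_scaleR_right:
  "qbracket a (\<Sum>k\<in>A. c k *\<^sub>R b k) = (\<Sum>k\<in>A. c k *\<^sub>R qbracket a (b k))"
proof -
  have "a * (\<Sum>k\<in>A. c k *\<^sub>R b k) - (\<Sum>k\<in>A. c k *\<^sub>R b k) * a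
      = (\<Sum>k\<in>A. c k *\<^sub>R (a * b k - b k * a))"
    by (simp add: sum_distrib_left sum_distrib_right sum_subtractf scaleR_diff_right)
  then show ?thesis
    by (simp add: qbracket_def scaleR_sum_right mult.commute)
qed

lemma pderiv_at_eqI:
  "((\<lambda>t. f (x + t *\<^sub>R qe k)) has_vector_derivative D) (at 0) \<Longrightarrow> pderiv_at k f x = D"
  unfolding pderiv_at_def by (rule vector_derivative_at)

lemma C1_on_has_vector_derivative:
  assumes "C1_on \<Omega> f" "x \<in> \<Omega>" "k \<in> {0..3}"
  shows "((\<lambda>t. f (x + t *\<^sub>R qe k)) has_vector_derivative pderiv_at k f x) (at 0)"
  using assms unfolding C1_on_def pderiv_at_def by (simp add: vector_derivative_works)

lemma pderiv_at_qcomp: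
  assumes "C1_on \<Omega> f" "x \<in> \<Omega>" "k \<in> {0..3}"
  shows "pderiv_at k (\<lambda>y. qcomp j (f y)) x = qcomp j (pderiv_at k f x)"
  by (intro pderiv_at_eqI bounded_linear.has_vector_derivative[OF bounded_linear_qcomp]
      C1_on_has_vector_derivative[OF assms])

lemma pderiv_at_vecpart_mult:
  assumes "C1_on \<Omega> f" "x \<in> \<Omega>" "k \<in> {0..3}"
  shows "pderiv_at k (\<lambda>y. vecpart y * f y) x
    = vecpart (qe k) * f x + vecpart x * pderiv_at k f x"
proof (rule pderiv_at_eqI)
  have v: "((\<lambda>t. vecpart (x + t *\<^sub>R qe k)) has_vector_derivative vecpart (qe k)) (at 0)"
    unfolding vecpart_add_scaleR by (auto intro!: derivative_eq_intros)
  show "((\<lambda>t. vecpart (x + t *\<^sub>R qe k) * f (x + t *\<^sub>R qe k))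
      has_vector_derivative vecpart (qe k) * f x + vecpart x * pderiv_at k f x) (at 0)"
    using has_vector_derivative_mult[OF v C1_on_has_vector_derivative[OF assms]]
    by (simp add: add.commute)
qed

text \<open>The term \<open>- 3 f\<close> is \<open>D[\<^bold>x] f\<close>: the derivative \<open>\<partial>\<^sub>k \<^bold>x\<close> is \<open>e\<^sub>k\<close> for \<open>k = 1, 2, 3\<close> and vanishes
  for \<open>k = 0\<close>, and each imaginary unit has square \<open>- 1\<close>.\<close>

lemma fueter_vecpart_mult:
  assumes "C1_on \<Omega> f" "x \<in> \<Omega>"
  shows "fueter (\<lambda>y. vecpart y * f y) x
    = - 3 * f x + (\<Sum>k = 0..3. qe k * vecpart x * pderiv_at k f x)"
proof -
  have "fueter (\<lambda>y. vecpart y * f y) x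
      = (\<Sum>k = 0..3. qe k * vecpart (qe k)) * f x
        + (\<Sum>k = 0..3. qe k * vecpart x * pderiv_at k f x)"
    unfolding fueter_def
    by (simp add: pderiv_at_vecpart_mult[OF assms] distrib_left sum.distrib sum_distrib_right
        mult.assoc)
  moreover have "(\<Sum>k = 0..3. qe k * vecpart (qe k)) = (\<Sum>k = 1..3. qe k * qe k)"
    unfolding sum_from_0_split by (simp add: vecpart_qe)
  moreover have "(\<Sum>k = 1..3. qe k * qe k) = - 3"
    using qe_relations(2-4) by (simp add: numeral_eq_Suc)
  ultimately show ?thesis by simp
qed

lemma nu_anticommutator:
  "- 2 * nu f x = (\<Sum>k = 0..3. (vecpart x * qe k + qe k * vecpart x) * pderiv_at k f x)"
proof -
  have "- 2 * nu f x = (- 2) *\<^sub>R nu f x"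
    by (simp add: scaleR_conv_of_real)
  also have "\<dots> = 2 *\<^sub>R (vecpart x * pderiv_at 0 f x)
      + (\<Sum>k = 1..3. (- 2 * qcomp k x) *\<^sub>R pderiv_at k f x)"
    by (simp add: nu_def scaleR_diff_right scaleR_sum_right sum_negf)
  also have "2 *\<^sub>R (vecpart x * pderiv_at 0 f x)
      = (vecpart x * qe 0 + qe 0 * vecpart x) * pderiv_at 0 f x"
    by (simp add: qe_relations scaleR_2 distrib_right)
  also have "(\<Sum>k = 1..3. (- 2 * qcomp k x) *\<^sub>R pderiv_at k f x)
      = (\<Sum>k = 1..3. (vecpart x * qe k + qe k * vecpart x) * pderiv_at k f x)"
    by (rule sum.cong) (simp_all only: vecpart_anticommutator mult_scaleR_left mult_1_left)
  finally show ?thesis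
    unfolding sum_from_0_split .
qed

lemma vecpart_mult_fueter:
  "vecpart x * fueter f x
    = - nu f x + (\<Sum>k = 1..3. qbracket (vecpart x) (qe k) * pderiv_at k f x)"
proof -
  have "(\<Sum>k = 1..3. qbracket (vecpart x) (qe k) * pderiv_at k f x)
      = (\<Sum>k = 1..3. vecpart x * qe k * pderiv_at k f x)
        + (\<Sum>k = 1..3. qcomp k x *\<^sub>R pderiv_at k f x)"
    by (simp add: qbracket_vecpart_qe distrib_right sum.distrib)
  then show ?thesis
    unfolding fueter_def nu_def sum_from_0_split
    by (simp add: qe_relations distrib_left sum_distrib_left mult.assoc)
qed

text \<open>Both sides equal \<open>\<Sum>\<^sub>j \<Sum>\<^sub>k \<partial>\<^sub>k f\<^sub>j [a, e\<^sub>k] e\<^sub>j\<close>: the bracket is real linear, and the real numbers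
  \<open>\<partial>\<^sub>k f\<^sub>j\<close> commute with every quaternion. Summing over \<open>j\<close> first reassembles \<open>\<partial>\<^sub>k f\<close>.\<close>

lemma sum_qbracket_Grad:
  assumes "C1_on \<Omega> f" "x \<in> \<Omega>"
  shows "(\<Sum>j = 0..3. qbracket a (Grad (\<lambda>y. qcomp j (f y)) x) * qe j)
    = (\<Sum>k = 1..3. qbracket a (qe k) * pderiv_at k f x)"
proof -
  have "(\<Sum>j = 0..3. qbracket a (Grad (\<lambda>y. qcomp j (f y)) x) * qe j)
      = (\<Sum>j = 0..3. \<Sum>k = 1..3. qbracket a (qe k) * (qcomp j (pderiv_at k f x) *\<^sub>R qe j))"
    unfolding Grad_def qbracket_sum_scaleR_right
    by (simp add: pderiv_at_qcomp[OF assms] sum_distrib_right)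
  also have "\<dots>
      = (\<Sum>k = 1..3. qbracket a (qe k) * (\<Sum>j = 0..3. qcomp j (pderiv_at k f x) *\<^sub>R qe j))"
    by (subst sum.swap) (simp add: sum_distrib_left)
  finally show ?thesis
    by (simp flip: quat_expansion)
qed

theorem proposition3p1:
  fixes \<Omega> :: "quat set" and f :: "quat \<Rightarrow> quat"
  assumes "open \<Omega>" and "connected \<Omega>" and "\<Omega> \<noteq> {}"
    and "C1_on \<Omega> f"
  shows "(\<forall>x\<in>\<Omega>. - 2 * nu f x =
           vecpart x * fueter f x + fueter (\<lambda>y. vecpart y * f y) x + 3 * f x) \<and>
         (\<forall>x\<in>\<Omega>. nu f x =
           - vecpart x * fueter f x
             + (\<Sum>k = 0..3. qbracket (vecpart x) (Grad (\<lambda>y. qcomp k (f y)) x) * qe k))"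
proof (intro conjI ballI)
  fix x assume x: "x \<in> \<Omega>"
  have "vecpart x * fueter f x + fueter (\<lambda>y. vecpart y * f y) x + 3 * f x
      = (\<Sum>k = 0..3. vecpart x * qe k * pderiv_at k f x)
        + (\<Sum>k = 0..3. qe k * vecpart x * pderiv_at k f x)"
    unfolding fueter_vecpart_mult[OF assms(4) x]
    by (simp add: fueter_def sum_distrib_left mult.assoc)
  then show "- 2 * nu f x
      = vecpart x * fueter f x + fueter (\<lambda>y. vecpart y * f y) x + 3 * f x"
    unfolding nu_anticommutator by (simp add: distrib_right sum.distrib)
next
  fix x assume x: "x \<in> \<Omega>"
  show "nu f x = - vecpart x * fueter f x
      + (\<Sum>k = 0..3. qbracket (vecpart x) (Grad (\<lambda>y. qcomp k (f y)) x) * qe k)"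
    unfolding sum_qbracket_Grad[OF assms(4) x]
    using vecpart_mult_fueter[of x f] by simp
qed

end
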